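(* Up to $O(1)$ multiplicative factors (absolute constants), for any (possibly partial) Boolean function $f:\mathcal{D}\subseteq\{0,1\}^n\to\{0,1\}$, $$\mathsf{Q}_{\mathsf{E}}^{\mathsf{cert}}(f)=\mathsf{Q}_0^{\mathsf{cert}}(f)\le \mathsf{Q}_0(f).$$
   Context: A (possibly partial) Boolean function is a map $f:\mathcal{D}\to\{0,1\}$ with $\mathcal{D}\subseteq\{0,1\}^n$. For $z\in\mathcal{D}$, $f^{\mathsf{cert}}_z$ is the partial function with domain $\{z\}\cup\{y\in\mathcal{D}: f(y)\ne f(z)\}$, with $f^{\mathsf{cert}}_z(z)=1$ and $f^{\mathsf{cert}}_z(y)=0$ whenever $f(y)\neq f(z)$. For a complexity measure $\mathsf{M}$, $\mathsf{M}^{\mathsf{cert}}(f):=\max_{z\in\mathcal{D}}\mathsf{M}(f^{\mathsf{cert}}_z)$. In the standard quantum query model: $\mathsf{Q}_{\mathsf{E}}(f)$ is the minimum number of queries of a quantum algorithm that outputs $f(x)$ with probability $1$ on every $x\in\mathcal{D}$. $\mathsf{Q}_0(f)$ is the minimum number of queries of a quantum algorithm with outputs in $\{0,1,\bot\}$ that, on every $x\in\mathcal{D}$, outputs $\bot$ with probability at most $1/2$ and never outputs $1-f(x)$ (i.e. whenever it outputs a Boolean value $b$, $b=f(x)$ with probability $1$). *)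

theory Defs
  imports "Jordan_Normal_Form.Schur_Decomposition" "HOL-Library.Extended_Nat"
begin

text \<open>A partial Boolean function on $n$ bits is a map \<open>f :: bool list \<rightharpoonup> bool\<close> whose domain consists
  of lists of length $n$.\<close>

definition partial_boolean_function :: "nat \<Rightarrow> (bool list \<rightharpoonup> bool) \<Rightarrow> bool" where
  "partial_boolean_function n f \<longleftrightarrow> dom f \<subseteq> {x. length x = n}"

definition cert_fun :: "(bool list \<rightharpoonup> bool) \<Rightarrow> bool list \<Rightarrow> (bool list \<rightharpoonup> bool)" where
  "cert_fun f z = (\<lambda>y. if y = z then Some True
                        else if y \<in> dom f \<and> f y \<noteq> f z then Some False
                        else None)"

text \<open>The domain of \<open>f\<close> is finite, so the supremum is a maximum; it is 0 for the empty domain.\<close>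

definition cert_measure ::
    "((bool list \<rightharpoonup> bool) \<Rightarrow> enat) \<Rightarrow> (bool list \<rightharpoonup> bool) \<Rightarrow> enat" where
  "cert_measure M f = (SUP z\<in>dom f. M (cert_fun f z))"

definition unitary_mat :: "nat \<Rightarrow> complex mat \<Rightarrow> bool" where
  "unitary_mat d U \<longleftrightarrow> U \<in> carrier_mat d d \<and> mat_adjoint U * U = 1\<^sub>m d"

text \<open>The computational basis state $|i, b, a\rangle$ with query index $i \le n$, target bit
  $b \in \{0,1\}$ and workspace content $a < w$ is numbered $k = 2 ((n+1) a + i) + b$.
  The oracle maps $|i, b, a\rangle$ to $|i, b \oplus x_i, a\rangle$ for $i < n$. The index
  $i = n$ is a null query, i.e. $x_n = 0$ by convention; for $n \ge 1$ it gives no additional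
  power (query any index with the target bit in the state $(|0\rangle + |1\rangle)/\sqrt 2$), and it
  keeps the state space non-trivial for $n = 0$.\<close>

definition query_index :: "nat \<Rightarrow> nat \<Rightarrow> nat" where
  "query_index n k = (k div 2) mod (n + 1)"

definition query_basis :: "bool list \<Rightarrow> nat \<Rightarrow> nat" where
  "query_basis x k =
    (let i = query_index (length x) k in
     if i < length x \<and> x ! i then (if even k then k + 1 else k - 1) else k)"

definition oracle_mat :: "nat \<Rightarrow> bool list \<Rightarrow> complex mat" where
  "oracle_mat d x = mat d d (\<lambda>(r, c). if r = query_basis x c then 1 else 0)"

text \<open>An algorithm alternates the input-independent unitaries \<open>gate 0, \<dots>, gate T\<close> with
  \<open>T = queries\<close> oracle calls. The final state is measured in the computational basis, and
  the measured basis state \<open>k\<close> yields the output \<open>outcome k\<close>.\<close>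

record 'o query_algorithm =
  workspace :: nat
  queries :: nat
  gate :: "nat \<Rightarrow> complex mat"
  outcome :: "nat \<Rightarrow> 'o"

definition state_dim :: "nat \<Rightarrow> 'o query_algorithm \<Rightarrow> nat" where
  "state_dim n A = 2 * (n + 1) * workspace A"

definition quantum_algorithm :: "nat \<Rightarrow> 'o query_algorithm \<Rightarrow> bool" where
  "quantum_algorithm n A \<longleftrightarrow>
    workspace A > 0 \<and> (\<forall>t\<le>queries A. unitary_mat (state_dim n A) (gate A t))"

primrec state_after :: "nat \<Rightarrow> (nat \<Rightarrow> complex mat) \<Rightarrow> bool list \<Rightarrow> nat \<Rightarrow> complex vec" where
  "state_after d U x 0 = U 0 *\<^sub>v unit_vec d 0"
| "state_after d U x (Suc t) = U (Suc t) *\<^sub>v (oracle_mat d x *\<^sub>v state_after d U x t)"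

definition output_prob :: "'o query_algorithm \<Rightarrow> bool list \<Rightarrow> 'o \<Rightarrow> real" where
  "output_prob A x r =
    (let d = state_dim (length x) A in
     \<Sum>k | k < d \<and> outcome A k = r. (cmod (state_after d (gate A) x (queries A) $ k))\<^sup>2)"

definition computes_exactly :: "bool query_algorithm \<Rightarrow> (bool list \<rightharpoonup> bool) \<Rightarrow> bool" where
  "computes_exactly A f \<longleftrightarrow> (\<forall>x\<in>dom f. output_prob A x (the (f x)) = 1)"

text \<open>The output \<open>None\<close> stands for $\bot$.\<close>

definition computes_zero_error :: "bool option query_algorithm \<Rightarrow> (bool list \<rightharpoonup> bool) \<Rightarrow> bool" where
  "computes_zero_error A f \<longleftrightarrow>
    (\<forall>x\<in>dom f. output_prob A x None \<le> 1 / 2 \<and> output_prob A x (Some (\<not> the (f x))) = 0)"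

text \<open>Infima of sets of extended naturals are minima for non-empty sets. The sets
  below are non-empty for every partial Boolean function on $n$ bits, since the whole input
  can be read with $n$ queries.\<close>

definition Q_E :: "nat \<Rightarrow> (bool list \<rightharpoonup> bool) \<Rightarrow> enat" where
  "Q_E n f = (INF A\<in>{A. quantum_algorithm n A \<and> computes_exactly A f}. enat (queries A))"

definition Q_0 :: "nat \<Rightarrow> (bool list \<rightharpoonup> bool) \<Rightarrow> enat" where
  "Q_0 n f = (INF A\<in>{A. quantum_algorithm n A \<and> computes_zero_error A f}. enat (queries A))"

end

theory Submission
  imports Defs
begin

text \<open>Relabelling outcomes turns an exact algorithm into a zero-error one, and a zero-error
  algorithm for \<open>f\<close> into one for every certificate function of \<open>f\<close>. The remaining inequality is
  exact amplitude amplification. A zero-error algorithm for the certificate function at \<open>z\<close> never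
  answers 1 on the other inputs, and on \<open>z\<close> it answers 1 with a probability \<open>a \<ge> 1/2\<close> that is known
  in advance. Since \<open>a \<ge> 1/4\<close>, one round of amplitude amplification, with the two reflections
  replaced by suitable phase rotations, raises this probability to exactly 1, and it keeps
  probability 0 on the other inputs. The round runs the algorithm, its inverse, and the algorithm
  again, hence triples the number of queries.\<close>

section \<open>Unitary matrices\<close>

lemma dim_mat_adjoint [simp]:
  "dim_row (mat_adjoint A) = dim_col A" "dim_col (mat_adjoint A) = dim_row A"
  by (simp_all add: mat_adjoint_def)

lemma mat_adjoint_carrier [simp]:
  "A \<in> carrier_mat n m \<Longrightarrow> mat_adjoint A \<in> carrier_mat m n"
  by auto

lemma index_mat_adjoint [simp]:
  assumes "i < dim_col A" "j < dim_row A"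
  shows "mat_adjoint A $$ (i, j) = conjugate (A $$ (j, i))"
  using assms by (simp add: mat_adjoint_def mat_of_rows_index)

lemma mat_adjoint_mat_adjoint [simp]: "mat_adjoint (mat_adjoint A) = A"
  by (rule eq_matI) auto

lemma mat_adjoint_mult:
  fixes A :: "complex mat"
  assumes "A \<in> carrier_mat n m" "B \<in> carrier_mat m k"
  shows "mat_adjoint (A * B) = mat_adjoint B * mat_adjoint A"
  using assms
  by (intro eq_matI) (auto simp: scalar_prod_def sum_conjugate mult.commute intro!: sum.cong)

text \<open>Both sides are the same double sum with the order of summation exchanged. Norm
  preservation and the overlap computed in \<open>amplification_state\<close> rest on it.\<close>

lemma cscalar_prod_mult_mat_vec:
  fixes A :: "complex mat"
  assumes A: "A \<in> carrier_mat n m" and v: "v \<in> carrier_vec m" and w: "w \<in> carrier_vec n"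
  shows "(A *\<^sub>v v) \<bullet>c w = v \<bullet>c (mat_adjoint A *\<^sub>v w)"
proof -
  have "(A *\<^sub>v v) \<bullet>c w = (\<Sum>i<n. \<Sum>j<m. A $$ (i, j) * v $ j * cnj (w $ i))"
    using assms by (auto simp: scalar_prod_def sum_distrib_right atLeast0LessThan intro!: sum.cong)
  also have "\<dots> = (\<Sum>j<m. \<Sum>i<n. A $$ (i, j) * v $ j * cnj (w $ i))"
    by (rule sum.swap)
  also have "\<dots> = v \<bullet>c (mat_adjoint A *\<^sub>v w)"
    using assms by (auto simp: scalar_prod_def sum_distrib_left atLeast0LessThan mult_ac
        intro!: sum.cong)
  finally show ?thesis .
qed

lemma cscalar_prod_self:
  fixes v :: "complex vec"
  assumes "v \<in> carrier_vec d"
  shows "v \<bullet>c v = of_real (\<Sum>k<d. (cmod (v $ k))\<^sup>2)"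
  using assms by (auto simp: scalar_prod_def atLeast0LessThan complex_norm_square
      simp del: of_real_power intro!: sum.cong)

text \<open>Unlike the library rules, these have no variable that occurs in the premises only, which
  makes them usable by the simplifier.\<close>

lemma mult_mat_vec_carrier_square [simp]:
  "A \<in> carrier_mat d d \<Longrightarrow> v \<in> carrier_vec d \<Longrightarrow> A *\<^sub>v v \<in> carrier_vec d"
  by (rule mult_mat_vec_carrier)

lemma mult_carrier_mat_square [simp]:
  "A \<in> carrier_mat d d \<Longrightarrow> B \<in> carrier_mat d d \<Longrightarrow> A * B \<in> carrier_mat d d"
  by (rule mult_carrier_mat)

lemma unitary_mat_carrier [simp]: "unitary_mat d U \<Longrightarrow> U \<in> carrier_mat d d"
  by (simp add: unitary_mat_def)

text \<open>\<open>unitary_mat\<close> asks for a left inverse; for square matrices this is also a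
  right inverse.\<close>

lemma unitary_mat_adjoint:
  assumes "unitary_mat d U"
  shows "unitary_mat d (mat_adjoint U)"
  using assms mat_mult_left_right_inverse[of "mat_adjoint U" d U] by (simp add: unitary_mat_def)

lemma unitary_mat_mult_adjoint:
  assumes "unitary_mat d U"
  shows "U * mat_adjoint U = 1\<^sub>m d"
  using unitary_mat_adjoint[OF assms] by (simp add: unitary_mat_def)

lemma unitary_mat_mult:
  assumes "unitary_mat d U" "unitary_mat d V"
  shows "unitary_mat d (U * V)"
proof -
  have [simp]: "U \<in> carrier_mat d d" "V \<in> carrier_mat d d" using assms by auto
  have "mat_adjoint (U * V) * (U * V) = mat_adjoint V * (mat_adjoint U * (U * V))"
    by (simp add: mat_adjoint_mult[of _ d d _ d] assoc_mult_mat[of _ d d _ d _ d])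
  also have "mat_adjoint U * (U * V) = V"
    using assms by (simp add: assoc_mult_mat[of _ d d _ d _ d, symmetric] left_mult_one_mat[of _ d d]
        unitary_mat_def)
  finally show ?thesis
    using assms by (simp add: unitary_mat_def)
qed

lemma unitary_mat_norm:
  assumes U: "unitary_mat d U" and v: "v \<in> carrier_vec d"
  shows "(\<Sum>k<d. (cmod ((U *\<^sub>v v) $ k))\<^sup>2) = (\<Sum>k<d. (cmod (v $ k))\<^sup>2)"
proof -
  have [simp]: "U \<in> carrier_mat d d" using U by simp
  have "(U *\<^sub>v v) \<bullet>c (U *\<^sub>v v) = v \<bullet>c (mat_adjoint U *\<^sub>v (U *\<^sub>v v))"
    using v by (intro cscalar_prod_mult_mat_vec[of _ d d]) auto
  also have "mat_adjoint U *\<^sub>v (U *\<^sub>v v) = v"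
    using U v by (simp add: assoc_mult_mat_vec[of _ d d _ d, symmetric] unitary_mat_def)
  finally have "(U *\<^sub>v v) \<bullet>c (U *\<^sub>v v) = v \<bullet>c v" .
  moreover have "U *\<^sub>v v \<in> carrier_vec d"
    using v by simp
  ultimately show ?thesis
    unfolding cscalar_prod_self[OF v] by (simp only: cscalar_prod_self of_real_eq_iff)
qed

text \<open>For \<open>u = -1\<close> this is the reflection of ordinary amplitude amplification; a
  general phase \<open>u\<close> gives the freedom needed for exactness.\<close>

definition phase_mat :: "nat \<Rightarrow> (nat \<Rightarrow> bool) \<Rightarrow> complex \<Rightarrow> complex mat" where
  "phase_mat d P u = mat d d (\<lambda>(i, j). if i = j then if P i then u else 1 else 0)"

lemma phase_mat_carrier [simp]: "phase_mat d P u \<in> carrier_mat d d"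
  by (simp add: phase_mat_def)

lemma dim_phase_mat [simp]: "dim_row (phase_mat d P u) = d" "dim_col (phase_mat d P u) = d"
  by (simp_all add: phase_mat_def)

lemma phase_mat_mult_vec:
  assumes "v \<in> carrier_vec d" "k < d"
  shows "(phase_mat d P u *\<^sub>v v) $ k = (if P k then u else 1) * v $ k"
  using assms by (simp add: phase_mat_def scalar_prod_def atLeast0LessThan
      if_distrib[where f = "\<lambda>c. c * _"] cong: if_cong)

lemma unitary_phase_mat:
  assumes "cmod u = 1"
  shows "unitary_mat d (phase_mat d P u)"
proof -
  have u: "cnj u * u = 1"
    using assms complex_norm_square[of u] by (simp add: mult.commute)
  have "mat_adjoint (phase_mat d P u) * phase_mat d P u = 1\<^sub>m d"
  proof (rule eq_matI)
    fix i j assume ij: "i < dim_row (1\<^sub>m d :: complex mat)" "j < dim_col (1\<^sub>m d :: complex mat)"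
    have "(mat_adjoint (phase_mat d P u) * phase_mat d P u) $$ (i, j)
      = (\<Sum>k<d. if k = i then if i = j then 1 else 0 else 0)"
    proof -
      have "(mat_adjoint (phase_mat d P u) * phase_mat d P u) $$ (i, j)
        = (\<Sum>k<d. cnj (phase_mat d P u $$ (k, i)) * phase_mat d P u $$ (k, j))"
        using ij by (simp add: scalar_prod_def atLeast0LessThan)
      also have "\<dots> = (\<Sum>k<d. if k = i then if i = j then 1 else 0 else 0)"
        using ij u by (intro sum.cong) (auto simp: phase_mat_def)
      finally show ?thesis .
    qed
    then show "(mat_adjoint (phase_mat d P u) * phase_mat d P u) $$ (i, j) = 1\<^sub>m d $$ (i, j)"
      using ij by simp
  qed (auto simp: phase_mat_def)
  then show ?thesis by (simp add: unitary_mat_def)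
qed

section \<open>Query circuits\<close>

lemma query_basis_less:
  assumes "even d" "k < d"
  shows "query_basis x k < d"
  using assms by (cases "even k") (auto simp: query_basis_def Let_def elim!: evenE)

text \<open>Flipping the target bit leaves the query index unchanged, so the second application
  reads the same input bit and undoes the flip.\<close>

lemma query_basis_query_basis: "query_basis x (query_basis x k) = k"
proof (cases "even k")
  case True
  then have "query_index m (k + 1) = query_index m k" for m
    by (simp add: query_index_def)
  with True show ?thesis by (simp add: query_basis_def Let_def)
next
  case False
  then have "query_index m (k - 1) = query_index m k" for m
    by (auto simp: query_index_def elim!: oddE)
  moreover have "even (k - 1)" "k \<noteq> 0" using False by (auto intro: odd_pos)
  ultimately show ?thesis using False by (auto simp: query_basis_def Let_def)
qed

lemma oracle_mat_carrier [simp]: "oracle_mat d x \<in> carrier_mat d d"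
  by (simp add: oracle_mat_def)

lemma dim_oracle_mat [simp]: "dim_row (oracle_mat d x) = d" "dim_col (oracle_mat d x) = d"
  by (simp_all add: oracle_mat_def)

text \<open>The permutation is an involution, so its 0/1 matrix is symmetric. Hence an inverted
  circuit can call the same oracle.\<close>

lemma mat_adjoint_oracle_mat: "mat_adjoint (oracle_mat d x) = oracle_mat d x"
  by (rule eq_matI) (auto simp: oracle_mat_def query_basis_query_basis)

lemma unitary_oracle_mat:
  assumes "even d"
  shows "unitary_mat d (oracle_mat d x)"
proof -
  have "oracle_mat d x * oracle_mat d x = 1\<^sub>m d"
  proof (rule eq_matI)
    fix i j assume ij: "i < dim_row (1\<^sub>m d :: complex mat)" "j < dim_col (1\<^sub>m d :: complex mat)"
    have "(oracle_mat d x * oracle_mat d x) $$ (i, j)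
      = (\<Sum>k<d. if k = query_basis x j then if i = query_basis x k then 1 else 0 else 0)"
    proof -
      have "(oracle_mat d x * oracle_mat d x) $$ (i, j)
        = (\<Sum>k<d. oracle_mat d x $$ (i, k) * oracle_mat d x $$ (k, j))"
        using ij by (simp add: scalar_prod_def atLeast0LessThan)
      also have "\<dots> = (\<Sum>k<d. if k = query_basis x j then if i = query_basis x k then 1 else 0 else 0)"
        using ij by (intro sum.cong) (auto simp: oracle_mat_def)
      finally show ?thesis .
    qed
    also have "\<dots> = (if i = j then 1 else 0)"
      using ij query_basis_less[OF assms, of j x] by (simp add: query_basis_query_basis)
    finally show "(oracle_mat d x * oracle_mat d x) $$ (i, j) = 1\<^sub>m d $$ (i, j)"
      using ij by simp
  qed (auto simp: oracle_mat_def)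
  then show ?thesis by (simp add: unitary_mat_def mat_adjoint_oracle_mat)
qed

text \<open>The operator behind \<open>state_after\<close>: amplification also needs the inverse of
  the circuit, which the final state alone does not determine.\<close>

primrec circuit_mat :: "nat \<Rightarrow> (nat \<Rightarrow> complex mat) \<Rightarrow> bool list \<Rightarrow> nat \<Rightarrow> complex mat" where
  "circuit_mat d U x 0 = U 0"
| "circuit_mat d U x (Suc t) = U (Suc t) * (oracle_mat d x * circuit_mat d U x t)"

lemma unitary_circuit_mat:
  assumes "even d" "\<forall>s\<le>t. unitary_mat d (U s)"
  shows "unitary_mat d (circuit_mat d U x t)"
  using assms by (induction t) (auto intro!: unitary_mat_mult unitary_oracle_mat)

lemma state_after_eq_circuit_mat:
  assumes "even d" "\<forall>s\<le>t. unitary_mat d (U s)"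
  shows "state_after d U x t = circuit_mat d U x t *\<^sub>v unit_vec d 0"
  using assms(2)
proof (induction t)
  case (Suc t)
  have "U (Suc t) \<in> carrier_mat d d" "circuit_mat d U x t \<in> carrier_mat d d"
    using Suc.prems assms(1) by (simp_all add: unitary_circuit_mat)
  with Suc show ?case
    by (simp add: assoc_mult_mat_vec[of _ d d _ d])
qed simp

lemma circuit_mat_cong:
  assumes "\<And>s. s \<le> t \<Longrightarrow> U s = V s"
  shows "circuit_mat d U x t = circuit_mat d V x t"
  using assms by (induction t) auto

text \<open>The gates are chosen before the input \<open>x\<close>, so \<open>V\<close> depends on
  \<open>x\<close> only through \<open>T\<close> oracle calls. Query counts then follow from
  products of matrices.\<close>

definition implementable :: "nat \<Rightarrow> nat \<Rightarrow> (bool list \<Rightarrow> complex mat) \<Rightarrow> bool" where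
  "implementable d T V \<longleftrightarrow>
    (\<exists>U. (\<forall>t\<le>T. unitary_mat d (U t)) \<and> (\<forall>x. circuit_mat d U x T = V x))"

lemma implementable_circuit_mat:
  "\<forall>t\<le>T. unitary_mat d (U t) \<Longrightarrow> implementable d T (\<lambda>x. circuit_mat d U x T)"
  by (auto simp: implementable_def)

lemma implementable_const: "unitary_mat d W \<Longrightarrow> implementable d 0 (\<lambda>x. W)"
  by (auto simp: implementable_def)

lemma unitary_mat_one: "unitary_mat d (1\<^sub>m d)"
proof -
  have "mat_adjoint (1\<^sub>m d :: complex mat) = 1\<^sub>m d"
    by (rule eq_matI) auto
  then show ?thesis by (simp add: unitary_mat_def)
qed

lemma implementable_oracle: "implementable d 1 (oracle_mat d)"
  unfolding implementable_def
  by (rule exI[of _ "\<lambda>_. 1\<^sub>m d"])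
     (auto simp: unitary_mat_one left_mult_one_mat[of _ d d] right_mult_one_mat[of _ d d])

text \<open>The last gate of the first circuit is merged with the first gate of the second one.\<close>

lemma implementable_mult:
  assumes d: "even d" and V: "implementable d S V" and W: "implementable d T W"
  shows "implementable d (S + T) (\<lambda>x. W x * V x)"
proof -
  obtain A where A: "\<forall>t\<le>S. unitary_mat d (A t)" "\<And>x. circuit_mat d A x S = V x"
    using V by (auto simp: implementable_def)
  obtain B where B: "\<forall>t\<le>T. unitary_mat d (B t)" "\<And>x. circuit_mat d B x T = W x"
    using W by (auto simp: implementable_def)
  define U where "U t = (if t < S then A t else if t = S then B 0 * A S else B (t - S))" for t
  have unitary: "\<forall>t\<le>S + T. unitary_mat d (U t)"
    using A(1) B(1) by (auto simp: U_def intro!: unitary_mat_mult)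
  have carrier: "A t \<in> carrier_mat d d" if "t \<le> S" for t
    using A(1) that by auto
  have carrier': "B t \<in> carrier_mat d d" if "t \<le> T" for t
    using B(1) that by auto
  have "circuit_mat d U x (S + t) = circuit_mat d B x t * V x" if "t \<le> T" for x t
    using that
  proof (induction t)
    case 0
    show ?case
    \<comment> \<open>For \<open>S = 0\<close> no oracle call precedes the merged gate, so there is
      no shorter prefix of the circuit to split off.\<close>
    proof (cases S)
      case 0
      then show ?thesis using A(2)[of x] by (simp add: U_def)
    next
      case (Suc s)
      have "circuit_mat d U x s = circuit_mat d A x s"
        by (rule circuit_mat_cong) (simp add: U_def Suc)
      then have "circuit_mat d U x (S + 0) = (B 0 * A S) * (oracle_mat d x * circuit_mat d A x s)"
        by (simp add: Suc U_def)
      also have "\<dots> = B 0 * (A S * (oracle_mat d x * circuit_mat d A x s))"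
        using A(1) B(1) Suc d
        by (intro assoc_mult_mat[of _ d d _ d _ d] mult_carrier_mat_square unitary_mat_carrier
            unitary_circuit_mat unitary_oracle_mat) auto
      also have "\<dots> = circuit_mat d B x 0 * V x"
        using A(2)[of x] by (simp add: Suc)
      finally show ?thesis .
    qed
  next
    case (Suc t)
    have "circuit_mat d B x t \<in> carrier_mat d d"
      using B(1) Suc d by (auto intro!: unitary_mat_carrier unitary_circuit_mat)
    moreover have "V x \<in> carrier_mat d d"
      using A d unitary_circuit_mat unitary_mat_carrier by metis
    ultimately show ?case
      using Suc carrier'[of "Suc t"]
      by (auto simp: U_def assoc_mult_mat[of _ d d _ d _ d])
  qed
  then have "\<forall>x. circuit_mat d U x (S + T) = W x * V x"
    using B(2) by simp
  with unitary show ?thesis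
    unfolding implementable_def by (intro exI[of _ U] conjI)
qed

text \<open>The adjoint reverses the order of the factors and inverts each gate, while the oracle is
  its own adjoint. The number of queries therefore stays the same.\<close>

lemma implementable_adjoint:
  assumes d: "even d" and U: "\<forall>t\<le>T. unitary_mat d (U t)"
  shows "implementable d T (\<lambda>x. mat_adjoint (circuit_mat d U x T))"
  using U
proof (induction T)
  case 0
  then show ?case by (simp add: implementable_const unitary_mat_adjoint)
next
  case (Suc T)
  \<comment> \<open>The summands count the queries of the inverted last gate, of the oracle, and of
    the inverted shorter circuit.\<close>
  have "implementable d (0 + 1 + T)
      (\<lambda>x. mat_adjoint (circuit_mat d U x T) * (oracle_mat d x * mat_adjoint (U (Suc T))))"
    using Suc by (intro implementable_mult d implementable_oracle implementable_const
        unitary_mat_adjoint) auto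
  moreover have "mat_adjoint (circuit_mat d U x (Suc T))
      = mat_adjoint (circuit_mat d U x T) * (oracle_mat d x * mat_adjoint (U (Suc T)))" for x
  proof -
    have [simp]: "circuit_mat d U x T \<in> carrier_mat d d" "U (Suc T) \<in> carrier_mat d d"
      using Suc.prems d by (auto intro!: unitary_mat_carrier unitary_circuit_mat)
    show ?thesis
      by (simp add: mat_adjoint_mult[of _ d d _ d] mat_adjoint_oracle_mat
          assoc_mult_mat[of _ d d _ d _ d])
  qed
  ultimately show ?case by simp
qed

section \<open>Output probabilities\<close>

lemma even_state_dim: "even (state_dim n A)"
  by (simp add: state_dim_def)

lemma state_dim_pos: "quantum_algorithm n A \<Longrightarrow> 0 < state_dim n A"
  by (simp add: quantum_algorithm_def state_dim_def)

lemma output_prob_eq_0_iff: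
  "output_prob A x r = 0 \<longleftrightarrow>
    (let d = state_dim (length x) A in
      \<forall>k<d. outcome A k = r \<longrightarrow> state_after d (gate A) x (queries A) $ k = 0)"
  by (auto simp: output_prob_def Let_def sum_nonneg_eq_0_iff)

lemma unitary_mat_unit_vec_norm:
  assumes U: "unitary_mat d U" and d: "0 < d"
  shows "(\<Sum>k<d. (cmod ((U *\<^sub>v unit_vec d 0) $ k))\<^sup>2) = 1"
proof -
  have "(\<Sum>k<d. (cmod (unit_vec d 0 $ k))\<^sup>2) = (\<Sum>k<d. if k = 0 then 1 else 0)"
    by (intro sum.cong) auto
  also have "\<dots> = (1 :: real)"
    using d by simp
  finally show ?thesis
    using unitary_mat_norm[OF U unit_vec_carrier[of d 0]] by (simp only:)
qed

text \<open>The outcomes partition the basis states, and unitary gates preserve the norm 1 of the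
  initial state.\<close>

lemma sum_output_prob:
  fixes A :: "'o::finite query_algorithm"
  assumes A: "quantum_algorithm (length x) A"
  shows "(\<Sum>r\<in>UNIV. output_prob A x r) = 1"
proof -
  let ?d = "state_dim (length x) A"
  let ?s = "state_after ?d (gate A) x (queries A)"
  have gates: "\<forall>t\<le>queries A. unitary_mat ?d (gate A t)"
    using A by (simp add: quantum_algorithm_def)
  have "(\<Sum>r\<in>UNIV. output_prob A x r) =
      (\<Sum>r\<in>UNIV. \<Sum>k | k \<in> {..<?d} \<and> outcome A k = r. (cmod (?s $ k))\<^sup>2)"
    by (simp add: output_prob_def Let_def)
  also have "\<dots> = (\<Sum>k<?d. (cmod (?s $ k))\<^sup>2)"
    by (rule sum.group) auto
  also have "\<dots> = 1"
    unfolding state_after_eq_circuit_mat[OF even_state_dim gates]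
    by (intro unitary_mat_unit_vec_norm unitary_circuit_mat even_state_dim gates state_dim_pos A)
  finally show ?thesis .
qed

lemma output_prob_Not:
  assumes "quantum_algorithm (length x) A"
  shows "output_prob A x (\<not> b) = 1 - output_prob A x b"
  using sum_output_prob[OF assms] by (cases b) (simp_all add: UNIV_bool)

section \<open>Classical post-processing of the measured outcome, at no query cost\<close>

definition relabel :: "('o \<Rightarrow> 'p) \<Rightarrow> 'o query_algorithm \<Rightarrow> 'p query_algorithm" where
  "relabel g A = \<lparr>workspace = workspace A, queries = queries A, gate = gate A,
    outcome = g \<circ> outcome A\<rparr>"

lemma queries_relabel [simp]: "queries (relabel g A) = queries A"
  by (simp add: relabel_def)

lemma quantum_algorithm_relabel [simp]:
  "quantum_algorithm n (relabel g A) \<longleftrightarrow> quantum_algorithm n A"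
  by (simp add: relabel_def quantum_algorithm_def state_dim_def)

lemma output_prob_relabel:
  assumes "\<And>s. g s = r \<longleftrightarrow> s = t"
  shows "output_prob (relabel g A) x r = output_prob A x t"
  using assms by (simp add: relabel_def output_prob_def state_dim_def)

lemma output_prob_relabel_0:
  assumes "\<And>s. g s \<noteq> r"
  shows "output_prob (relabel g A) x r = 0"
  using assms by (simp add: relabel_def output_prob_def state_dim_def)

section \<open>Exact amplitude amplification\<close>

text \<open>The numbers \<open>1 / (1 - w)\<close> with \<open>\<bar>w\<bar> = 1\<close> form the line \<open>Re = 1/2\<close>, so \<open>u\<close> only has to satisfy
  \<open>1 - a + a * Re u = 1/2\<close>.\<close>

lemma amplification_phases:
  fixes a :: real
  assumes "1 / 4 \<le> a"
  obtains u w :: complex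
  where "cmod u = 1" "cmod w = 1" "(1 - w) * (u * of_real a + (1 - of_real a)) = 1"
proof -
  \<comment> \<open>\<open>p\<close> will be the real part of \<open>u\<close>, solved from
    \<open>1 - a + a * p = 1 / 2\<close>. For positive \<open>a\<close>, the bound
    \<open>1 / 4 \<le> a\<close> is equivalent to \<open>- 1 \<le> p\<close>.\<close>
  define p where "p = 1 - 1 / (2 * a)"
  have "0 < a" using assms by simp
  then have "- 1 \<le> p" "p \<le> 1"
    using assms by (auto simp: p_def field_simps)
  then have "p\<^sup>2 \<le> 1" by (simp add: abs_square_le_1 abs_le_iff)
  define u where "u = Complex p (sqrt (1 - p\<^sup>2))"
  define c where "c = u * of_real a + (1 - of_real a)"
  define w where "w = 1 - 1 / c"
  have Re_c: "Re c = 1 / 2"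
    using \<open>0 < a\<close> by (simp add: c_def u_def p_def field_simps)
  then have "c \<noteq> 0" by auto
  \<comment> \<open>A point with real part 1/2 is equidistant from 0 and 1, and \<open>w\<close>
    equals \<open>(c - 1) / c\<close>.\<close>
  have "cmod (c - 1) = cmod c"
    by (simp add: cmod_def Re_c power2_eq_square)
  then have "cmod w = 1"
    using \<open>c \<noteq> 0\<close> by (simp add: w_def diff_divide_eq_iff norm_divide)
  moreover have "cmod u = 1"
    using \<open>p\<^sup>2 \<le> 1\<close> by (simp add: u_def cmod_def)
  moreover have "(1 - w) * (u * of_real a + (1 - of_real a)) = 1"
    using \<open>c \<noteq> 0\<close> by (simp add: w_def flip: c_def)
  ultimately show thesis using that by blast
qed

text \<open>Conjugated by \<open>V\<close>, the phase gate at 0 is the identity minus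
  \<open>1 - w\<close> times the projection onto \<open>\<psi>\<close>. The phase-shifted
  \<open>\<psi>\<close> has overlap \<open>u * a + (1 - a)\<close> with \<open>\<psi>\<close>, so
  the round subtracts a multiple of \<open>\<psi>\<close> from it and only rescales each
  amplitude.\<close>

lemma amplification_state:
  fixes V :: "complex mat" and u w :: complex and P :: "nat \<Rightarrow> bool"
  assumes V: "unitary_mat d V" and k: "k < d"
  defines "\<psi> \<equiv> V *\<^sub>v unit_vec d 0"
  defines "a \<equiv> \<Sum>k | k < d \<and> P k. (cmod (\<psi> $ k))\<^sup>2"
  shows "((V * (phase_mat d (\<lambda>k. k = 0) w * (mat_adjoint V * (phase_mat d P u * V))))
      *\<^sub>v unit_vec d 0) $ k
    = ((if P k then u else 1) - (1 - w) * (u * of_real a + (1 - of_real a))) * \<psi> $ k"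
proof -
  have [simp]: "V \<in> carrier_mat d d" using V by simp
  have [simp]: "\<psi> \<in> carrier_vec d"
    unfolding \<psi>_def by simp
  have d: "0 < d" using k by simp
  define \<chi> where "\<chi> = phase_mat d P u *\<^sub>v \<psi>"
  define \<phi> where "\<phi> = mat_adjoint V *\<^sub>v \<chi>"
  define c where "c = u * of_real a + (1 - of_real a)"
  have [simp]: "\<chi> \<in> carrier_vec d" unfolding \<chi>_def by simp
  have [simp]: "\<phi> \<in> carrier_vec d" unfolding \<phi>_def by simp
  have "V *\<^sub>v \<phi> = \<chi>"
    using unitary_mat_mult_adjoint[OF V]
    by (simp add: \<phi>_def assoc_mult_mat_vec[of _ d d _ d, symmetric])
  have "(\<Sum>k | k < d \<and> P k. (cmod (\<psi> $ k))\<^sup>2) + (\<Sum>k | k < d \<and> \<not> P k. (cmod (\<psi> $ k))\<^sup>2)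
      = (\<Sum>k<d. (cmod (\<psi> $ k))\<^sup>2)"
    by (subst sum.union_disjoint[symmetric]) (auto intro!: sum.cong)
  also have "\<dots> = 1"
    unfolding \<psi>_def using V d by (rule unitary_mat_unit_vec_norm)
  finally have compl: "(\<Sum>k | k < d \<and> \<not> P k. (cmod (\<psi> $ k))\<^sup>2) = 1 - a"
    by (simp add: a_def)
  \<comment> \<open>Moving \<open>V\<close> across the inner product turns the amplitude at 0 into
    the overlap of \<open>\<chi>\<close> with \<open>\<psi>\<close>.\<close>
  have "\<phi> $ 0 = (\<Sum>i<d. if i = 0 then \<phi> $ 0 else 0)"
    using d by simp
  also have "\<dots> = \<phi> \<bullet>c unit_vec d 0"
    unfolding scalar_prod_def atLeast0LessThan by (rule sum.cong) auto
  also have "\<dots> = \<chi> \<bullet>c \<psi>"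
    by (simp add: \<phi>_def \<psi>_def cscalar_prod_mult_mat_vec[of _ d d])
  also have "\<dots> = (\<Sum>k<d. (if P k then u else 1) * of_real ((cmod (\<psi> $ k))\<^sup>2))"
    using \<open>\<psi> \<in> carrier_vec d\<close> unfolding \<chi>_def
    by (auto simp: scalar_prod_def atLeast0LessThan phase_mat_mult_vec complex_norm_square
        simp del: index_mult_mat_vec of_real_power intro!: sum.cong)
  also have "\<dots> = (\<Sum>k | k < d \<and> P k. u * of_real ((cmod (\<psi> $ k))\<^sup>2))
      + (\<Sum>k | k < d \<and> \<not> P k. of_real ((cmod (\<psi> $ k))\<^sup>2))"
  proof -
    have "{..<d} \<inter> {k. P k} = {k. k < d \<and> P k}" "{..<d} \<inter> - {k. P k} = {k. k < d \<and> \<not> P k}"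
      by auto
    then show ?thesis
      using sum.If_cases[of "{..<d}" P "\<lambda>k. u * of_real ((cmod (\<psi> $ k))\<^sup>2)"
          "\<lambda>k. of_real ((cmod (\<psi> $ k))\<^sup>2)"]
      by (simp add: if_distrib[where f = "\<lambda>c. c * _"] cong: if_cong)
  qed
  also have "\<dots> = c"
    by (simp add: c_def compl del: of_real_power of_real_sum
        flip: sum_distrib_left of_real_sum a_def)
  finally have \<phi>_0: "\<phi> $ 0 = c" .
  \<comment> \<open>Only component 0 changes, from \<open>c\<close> to \<open>w * c\<close>.\<close>
  have "phase_mat d (\<lambda>k. k = 0) w *\<^sub>v \<phi> = \<phi> - ((1 - w) * c) \<cdot>\<^sub>v unit_vec d 0"
  proof (rule eq_vecI)
    fix i assume "i < dim_vec (\<phi> - ((1 - w) * c) \<cdot>\<^sub>v unit_vec d 0)"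
    then have "i < d" by simp
    then show "(phase_mat d (\<lambda>k. k = 0) w *\<^sub>v \<phi>) $ i = (\<phi> - ((1 - w) * c) \<cdot>\<^sub>v unit_vec d 0) $ i"
      using phase_mat_mult_vec[of \<phi> d i] \<phi>_0 by (auto simp: algebra_simps)
  qed (simp add: phase_mat_def)
  then have "V *\<^sub>v (phase_mat d (\<lambda>k. k = 0) w *\<^sub>v \<phi>) = \<chi> - ((1 - w) * c) \<cdot>\<^sub>v \<psi>"
    using \<open>V *\<^sub>v \<phi> = \<chi>\<close>
    by (simp add: mult_minus_distrib_mat_vec[of _ d d] mult_mat_vec[of _ d d] \<psi>_def)
  moreover have "(V * (phase_mat d (\<lambda>k. k = 0) w * (mat_adjoint V * (phase_mat d P u * V))))
      *\<^sub>v unit_vec d 0 = V *\<^sub>v (phase_mat d (\<lambda>k. k = 0) w *\<^sub>v \<phi>)"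
    by (simp add: \<phi>_def \<chi>_def \<psi>_def assoc_mult_mat_vec[of _ d d _ d])
  moreover have "\<chi> $ k = (if P k then u else 1) * \<psi> $ k"
    using k by (simp add: \<chi>_def phase_mat_mult_vec del: index_mult_mat_vec)
  moreover have "(\<chi> - ((1 - w) * c) \<cdot>\<^sub>v \<psi>) $ k = \<chi> $ k - (1 - w) * c * \<psi> $ k"
    using k carrier_vecD[OF \<open>\<psi> \<in> carrier_vec d\<close>]
    by (simp only: index_minus_vec index_smult_vec)
  ultimately show ?thesis
    by (simp only: c_def left_diff_distrib)
qed

text \<open>One choice of phases serves all inputs: on \<open>z\<close> it cancels the unwanted
  amplitudes, and wherever the amplitudes of \<open>Some True\<close> vanish, rescaling keeps them
  zero.\<close>

lemma exact_amplification:
  fixes A :: "bool option query_algorithm"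
  assumes A: "quantum_algorithm n A" and z: "length z = n"
    and prob: "1 / 4 \<le> output_prob A z (Some True)"
  obtains B :: "bool query_algorithm"
  where "quantum_algorithm n B" "queries B = 3 * queries A" "output_prob B z True = 1"
    and "\<And>y. length y = n \<Longrightarrow> output_prob A y (Some True) = 0 \<Longrightarrow> output_prob B y False = 1"
proof -
  define T where "T = queries A"
  define d where "d = state_dim n A"
  define V where "V x = circuit_mat d (gate A) x T" for x
  define P where "P k \<longleftrightarrow> outcome A k = Some True" for k
  define a where "a x = output_prob A x (Some True)" for x
  have d: "even d" "0 < d"
    using A by (simp_all add: d_def even_state_dim state_dim_pos)
  have gates: "\<forall>t\<le>T. unitary_mat d (gate A t)"
    using A by (simp add: quantum_algorithm_def d_def T_def)
  have V: "unitary_mat d (V x)" for x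
    unfolding V_def by (intro unitary_circuit_mat d gates)
  have state: "state_after d (gate A) x T = V x *\<^sub>v unit_vec d 0" for x
    unfolding V_def by (intro state_after_eq_circuit_mat d gates)
  \<comment> \<open>The phases are tuned to the success probability at the fixed point
    \<open>z\<close>, so the gates stay independent of the actual input.\<close>
  obtain u w :: complex where uw: "cmod u = 1" "cmod w = 1"
    and phases: "(1 - w) * (u * of_real (a z) + (1 - of_real (a z))) = 1"
    using amplification_phases[of "a z"] prob by (auto simp: a_def)
  \<comment> \<open>The circuit, its inverse and the circuit again cost \<open>T\<close> queries
    each; the two phase gates cost none.\<close>
  have "implementable d (T + 0 + T + 0 + T)
    (\<lambda>x. V x * (phase_mat d (\<lambda>k. k = 0) w * (mat_adjoint (V x) * (phase_mat d P u * V x))))"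
    unfolding V_def
    by (intro implementable_mult d implementable_const unitary_phase_mat uw
        implementable_adjoint implementable_circuit_mat gates)
  moreover have "T + 0 + T + 0 + T = 3 * T"
    by simp
  ultimately have "implementable d (3 * T)
    (\<lambda>x. V x * (phase_mat d (\<lambda>k. k = 0) w * (mat_adjoint (V x) * (phase_mat d P u * V x))))"
    by (simp only:)
  then obtain U where U: "\<forall>t\<le>3 * T. unitary_mat d (U t)"
    "\<And>x. circuit_mat d U x (3 * T)
      = V x * (phase_mat d (\<lambda>k. k = 0) w * (mat_adjoint (V x) * (phase_mat d P u * V x)))"
    by (auto simp: implementable_def)
  define B where "B = \<lparr>workspace = workspace A, queries = 3 * T, gate = U, outcome = P\<rparr>"
  have B_simps: "queries B = 3 * T" "gate B = U" "outcome B = P" "state_dim n B = d"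
    by (simp_all add: B_def d_def state_dim_def)
  have B: "quantum_algorithm n B"
    using A U(1) by (auto simp: quantum_algorithm_def B_simps) (simp add: B_def)
  have final: "state_after d U x (3 * T) $ k
    = ((if P k then u else 1) - (1 - w) * (u * of_real (a x) + (1 - of_real (a x))))
      * state_after d (gate A) x T $ k"
    if "k < d" "length x = n" for x k
  proof -
    have "a x = (\<Sum>k | k < d \<and> P k. (cmod ((V x *\<^sub>v unit_vec d 0) $ k))\<^sup>2)"
      using that by (simp add: a_def output_prob_def P_def state flip: d_def T_def
          del: index_mult_mat_vec)
    then show ?thesis
      using amplification_state[OF V that(1), where P = P and u = u and w = w]
      by (simp add: state_after_eq_circuit_mat[OF d(1) U(1)] U(2) state del: index_mult_mat_vec)
  qed
  \<comment> \<open>At \<open>z\<close> the factor in \<open>final\<close> outside \<open>P\<close>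
    is \<open>1 - 1\<close>.\<close>
  have "output_prob B z False = 0"
    using z final[of _ z] phases by (simp add: output_prob_eq_0_iff B_simps)
  then have "output_prob B z True = 1"
    using output_prob_Not[of z B True] B z by simp
  moreover have "output_prob B y False = 1" if y: "length y = n" "output_prob A y (Some True) = 0" for y
  proof -
    have "state_after d (gate A) y T $ k = 0" if "k < d" "P k" for k
      using y that by (simp add: output_prob_eq_0_iff P_def flip: d_def T_def)
    then have "output_prob B y True = 0"
      using y final[of _ y] by (simp add: output_prob_eq_0_iff B_simps)
    then show ?thesis
      using output_prob_Not[of y B True] B y by simp
  qed
  ultimately show thesis
    using that B by (simp add: B_simps T_def)
qed

section \<open>Comparison of the query complexities\<close>

lemma partial_boolean_function_length:
  "partial_boolean_function n f \<Longrightarrow> x \<in> dom f \<Longrightarrow> length x = n"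
  by (auto simp: partial_boolean_function_def)

lemma dom_cert_fun: "z \<in> dom f \<Longrightarrow> dom (cert_fun f z) \<subseteq> dom f"
  by (auto simp: cert_fun_def split: if_splits)

text \<open>Points other than \<open>z\<close> on which \<open>f\<close> takes the value at
  \<open>z\<close> lie outside the domain, so comparing with that value always gives the right
  answer.\<close>

lemma the_cert_fun:
  "z \<in> dom f \<Longrightarrow> x \<in> dom (cert_fun f z) \<Longrightarrow> the (cert_fun f z x) = (the (f x) = the (f z))"
  by (auto simp: cert_fun_def split: if_splits)

lemma partial_boolean_function_cert_fun:
  "partial_boolean_function n f \<Longrightarrow> z \<in> dom f \<Longrightarrow> partial_boolean_function n (cert_fun f z)"
  using dom_cert_fun[of z f] by (auto simp: partial_boolean_function_def)

lemma INF_enat_attained: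
  fixes q :: "'a \<Rightarrow> enat"
  assumes "S \<noteq> {}"
  obtains s where "s \<in> S" "(INF s\<in>S. q s) = q s"
proof -
  have "Inf (q ` S) \<in> q ` S"
    using assms by (auto simp: Inf_enat_def intro: LeastI)
  then show thesis using that by auto
qed

text \<open>An infimum over the empty set is infinite, so a finite value already provides an optimal
  algorithm, and none has to be constructed.\<close>

lemma Q_0_attained:
  assumes "Q_0 n f \<noteq> \<infinity>"
  obtains A where "quantum_algorithm n A" "computes_zero_error A f" "Q_0 n f = enat (queries A)"
proof -
  have "{A. quantum_algorithm n A \<and> computes_zero_error A f} \<noteq> {}"
  proof
    assume "{A. quantum_algorithm n A \<and> computes_zero_error A f} = {}"
    then have "Q_0 n f = \<infinity>"
      unfolding Q_0_def by (simp only: INF_empty top_enat_def)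
    with assms show False ..
  qed
  from INF_enat_attained[OF this] show thesis
    using that unfolding Q_0_def by blast
qed

lemma Q_0_le: "quantum_algorithm n A \<Longrightarrow> computes_zero_error A f \<Longrightarrow> Q_0 n f \<le> enat (queries A)"
  unfolding Q_0_def by (rule INF_lower) simp

lemma Q_E_le: "quantum_algorithm n A \<Longrightarrow> computes_exactly A f \<Longrightarrow> Q_E n f \<le> enat (queries A)"
  unfolding Q_E_def by (rule INF_lower) simp

text \<open>An exact algorithm never answers \<open>None\<close> after relabelling by
  \<open>Some\<close>, and its wrong answer has the complementary probability 0.\<close>

lemma Q_0_le_Q_E:
  assumes f: "partial_boolean_function n f"
  shows "Q_0 n f \<le> Q_E n f"
  unfolding Q_E_def
proof (rule INF_greatest)
  fix A assume "A \<in> {A. quantum_algorithm n A \<and> computes_exactly A f}"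
  then have A: "quantum_algorithm n A" "computes_exactly A f" by auto
  have "computes_zero_error (relabel Some A) f"
    unfolding computes_zero_error_def
  proof
    fix x assume x: "x \<in> dom f"
    with A have "output_prob A x (\<not> the (f x)) = 0"
      using f partial_boolean_function_length[OF f x]
      by (simp add: output_prob_Not computes_exactly_def)
    then show "output_prob (relabel Some A) x None \<le> 1 / 2
        \<and> output_prob (relabel Some A) x (Some (\<not> the (f x))) = 0"
      using output_prob_relabel_0[of Some None A x]
        output_prob_relabel[of Some "Some (\<not> the (f x))" "\<not> the (f x)" A x] by simp
  qed
  then show "Q_0 n f \<le> enat (queries A)"
    using Q_0_le[of n "relabel Some A" f] A by simp
qed

text \<open>Since \<open>z\<close> is fixed, the value of \<open>f\<close> at \<open>z\<close> may
  be built into the outcome labels: the answer \<open>b\<close> becomes the test whether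
  \<open>b\<close> equals it, and \<open>None\<close> is kept. This is a bijection of outcomes, so
  all probabilities carry over.\<close>

lemma Q_0_cert_fun_le:
  assumes z: "z \<in> dom f"
  shows "Q_0 n (cert_fun f z) \<le> Q_0 n f"
  unfolding Q_0_def[of n f]
proof (rule INF_greatest)
  fix A assume "A \<in> {A. quantum_algorithm n A \<and> computes_zero_error A f}"
  then have A: "quantum_algorithm n A" "computes_zero_error A f" by auto
  define g where "g = map_option (\<lambda>b. b = the (f z))"
  have "computes_zero_error (relabel g A) (cert_fun f z)"
    unfolding computes_zero_error_def
  proof
    fix x assume x: "x \<in> dom (cert_fun f z)"
    have "output_prob (relabel g A) x None = output_prob A x None"
      by (rule output_prob_relabel) (simp add: g_def)
    moreover have "output_prob (relabel g A) x (Some (\<not> the (cert_fun f z x)))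
        = output_prob A x (Some (\<not> the (f x)))"
      by (rule output_prob_relabel) (auto simp: g_def the_cert_fun[OF z x])
    ultimately show "output_prob (relabel g A) x None \<le> 1 / 2
        \<and> output_prob (relabel g A) x (Some (\<not> the (cert_fun f z x))) = 0"
      using bspec[OF A(2)[unfolded computes_zero_error_def] subsetD[OF dom_cert_fun[OF z] x]]
      by simp
  qed
  then show "Q_0 n (cert_fun f z) \<le> enat (queries A)"
    using Q_0_le[of n "relabel g A"] A by simp
qed

text \<open>With a single 1-input \<open>z\<close>, answering 1 elsewhere is an error and has
  probability 0, which is the situation that \<open>exact_amplification\<close> requires.\<close>

lemma Q_E_le_Q_0:
  assumes g: "partial_boolean_function n g"
    and z: "g z = Some True" and others: "\<And>y. y \<noteq> z \<Longrightarrow> g y \<noteq> Some True"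
  shows "Q_E n g \<le> enat 3 * Q_0 n g"
proof (cases "Q_0 n g = \<infinity>")
  case False
  then obtain A where A: "quantum_algorithm n A" "computes_zero_error A g"
    and q: "Q_0 n g = enat (queries A)"
    by (rule Q_0_attained)
  have "z \<in> dom g" using z by auto
  then have len: "length z = n"
    using g by (rule partial_boolean_function_length[rotated])
  have "output_prob A z None \<le> 1 / 2" "output_prob A z (Some False) = 0"
    using bspec[OF A(2)[unfolded computes_zero_error_def] \<open>z \<in> dom g\<close>] z by simp_all
  \<comment> \<open>The three outcome probabilities sum to 1, which even leaves at least
    1/2.\<close>
  then have "1 / 4 \<le> output_prob A z (Some True)"
    using sum_output_prob[of z A] A(1) len by (simp add: UNIV_option_conv UNIV_bool)
  from exact_amplification[OF A(1) len this] obtain B :: "bool query_algorithm"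
    where B: "quantum_algorithm n B" "queries B = 3 * queries A" "output_prob B z True = 1"
    "\<And>y. length y = n \<Longrightarrow> output_prob A y (Some True) = 0 \<Longrightarrow> output_prob B y False = 1"
    by blast
  have "computes_exactly B g"
    unfolding computes_exactly_def
  proof
    fix y assume y: "y \<in> dom g"
    show "output_prob B y (the (g y)) = 1"
    proof (cases "y = z")
      case True
      then show ?thesis using B(3) z by simp
    next
      case False
      then have "g y = Some False" using others[of y] y by auto
      moreover have "output_prob A y (Some True) = 0"
        using bspec[OF A(2)[unfolded computes_zero_error_def] y] \<open>g y = Some False\<close> by simp
      ultimately show ?thesis
        using B(4)[of y] partial_boolean_function_length[OF g y] by simp
    qed
  qed
  then show ?thesis
    using Q_E_le[OF B(1)] B(2) q by simp
qed simp

theorem theorem5: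
  shows "\<exists>C::nat. \<forall>n (f :: bool list \<rightharpoonup> bool). partial_boolean_function n f \<longrightarrow>
           cert_measure (Q_E n) f \<le> enat C * cert_measure (Q_0 n) f \<and>
           cert_measure (Q_0 n) f \<le> enat C * cert_measure (Q_E n) f \<and>
           cert_measure (Q_0 n) f \<le> enat C * Q_0 n f"
\<comment> \<open>The factor 3 is the tripling of queries by amplification. The other two
  inequalities hold with factor 1 and are weakened by \<open>le_3\<close>.\<close>
proof (intro exI[of _ 3] allI impI conjI)
  fix n and f :: "bool list \<rightharpoonup> bool"
  assume f: "partial_boolean_function n f"
  have le_3: "q \<le> enat 3 * q" for q :: enat
    by (cases q) auto
  show "cert_measure (Q_E n) f \<le> enat 3 * cert_measure (Q_0 n) f"
    unfolding cert_measure_def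
  proof (rule SUP_least)
    fix z assume z: "z \<in> dom f"
    have "Q_E n (cert_fun f z) \<le> enat 3 * Q_0 n (cert_fun f z)"
      using partial_boolean_function_cert_fun[OF f z]
      by (rule Q_E_le_Q_0[where z = z]) (auto simp: cert_fun_def)
    also have "\<dots> \<le> enat 3 * (SUP z\<in>dom f. Q_0 n (cert_fun f z))"
      using z by (intro mult_left_mono SUP_upper) auto
    finally show "Q_E n (cert_fun f z) \<le> enat 3 * (SUP z\<in>dom f. Q_0 n (cert_fun f z))" .
  qed
  have "cert_measure (Q_0 n) f \<le> cert_measure (Q_E n) f"
    unfolding cert_measure_def
    by (rule SUP_mono) (auto intro!: Q_0_le_Q_E partial_boolean_function_cert_fun[OF f])
  then show "cert_measure (Q_0 n) f \<le> enat 3 * cert_measure (Q_E n) f"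
    using le_3 order_trans by blast
  have "cert_measure (Q_0 n) f \<le> Q_0 n f"
    unfolding cert_measure_def by (rule SUP_least) (rule Q_0_cert_fun_le)
  then show "cert_measure (Q_0 n) f \<le> enat 3 * Q_0 n f"
    using le_3 order_trans by blast
qed

end
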